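(* Let $N$ be a positive integer which is not a perfect square, let $p$ be an integer with $p^2<N$, let $q$ be a positive integer dividing $N-p^2$, and put $\alpha=\frac{\sqrt N+p}{q}$. Then the left-positive path (LPP) of $\alpha$ is purely periodic, i.e. there is a positive integer $T$ such that $x_{n+T}=x_n$ for every non-negative integer $n$, where $(x_n)_{n\ge0}$ is the sequence of numbers in the LPP of $\alpha$.
   Context: The Calkin-Wilf tree of $\alpha$ is the infinite binary tree whose root is labeled $\alpha$ and in which every vertex labeled $x$ has a left child labeled $\frac{x}{x+1}$ and a right child labeled $x+1$ (since $\alpha>0$, all labels are positive). Each vertex carries a triple $(\varepsilon,c,d)$ with $\varepsilon\in\{-1,1\}$, $c$ an integer, $d$ a positive integer dividing $N-c^2$, and label equal to $\frac{\varepsilon\sqrt N+c}{d}$, defined as follows. The root has triple $(1,p,q)$. If a vertex has triple $(\varepsilon,c,d)$, its right child has triple $(\varepsilon,c+d,d)$; its left child has triple $\left(-\varepsilon,\frac{N-c^2}{d}-c,\frac{N-(c+d)^2}{d}\right)$ if $N-(c+d)^2>0$, and $\left(\varepsilon,c-\frac{N-c^2}{d},\frac{(c+d)^2-N}{d}\right)$ otherwise. The left-positive path (LPP) of $\alpha$ is the infinite descending path which starts at the root and which, from each vertex, goes to the left child if the value of $\varepsilon$ for that left child is $1$, and to the right child otherwise. $x_n$ denotes the label of the $n$-th vertex of the LPP, with $x_0=\alpha$. *)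

theory Defs
  imports Complex_Main "HOL-Computational_Algebra.Nth_Powers"
begin

(* A vertex of the infinite binary tree is addressed by the finite sequence of child choices
   leading to it from the root; the LAST choice is at the head of the list. Thus [] is the root
   and L # v, R # v are the left and right children of v. *)

datatype child = L | R

type_synonym vertex = "child list"

fun cw_label :: "real \<Rightarrow> vertex \<Rightarrow> real" where
  "cw_label \<alpha> [] = \<alpha>"
| "cw_label \<alpha> (L # v) = cw_label \<alpha> v / (cw_label \<alpha> v + 1)"
| "cw_label \<alpha> (R # v) = cw_label \<alpha> v + 1"

type_synonym triple = "int \<times> int \<times> int"

fun right_triple :: "triple \<Rightarrow> triple" where
  "right_triple (\<epsilon>, c, d) = (\<epsilon>, c + d, d)"

(* Every integer division below is exact, because d divides N - c^2 at every vertex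
   (see cw_triple_correct). *)

fun left_triple :: "int \<Rightarrow> triple \<Rightarrow> triple" where
  "left_triple N (\<epsilon>, c, d) =
     (if N - (c + d)\<^sup>2 > 0
      then (- \<epsilon>, (N - c\<^sup>2) div d - c, (N - (c + d)\<^sup>2) div d)
      else (\<epsilon>, c - (N - c\<^sup>2) div d, ((c + d)\<^sup>2 - N) div d))"

fun cw_triple :: "int \<Rightarrow> int \<Rightarrow> int \<Rightarrow> vertex \<Rightarrow> triple" where
  "cw_triple N p q [] = (1, p, q)"
| "cw_triple N p q (L # v) = left_triple N (cw_triple N p q v)"
| "cw_triple N p q (R # v) = right_triple (cw_triple N p q v)"

definition quad_root :: "int \<Rightarrow> int \<Rightarrow> int \<Rightarrow> real" where
  "quad_root N p q = (sqrt (of_int N) + of_int p) / of_int q"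

(* The left-positive path: lpp_vertex is its sequence of vertices, lpp the sequence of their labels. *)

primrec lpp_vertex :: "int \<Rightarrow> int \<Rightarrow> int \<Rightarrow> nat \<Rightarrow> vertex" where
  "lpp_vertex N p q 0 = []"
| "lpp_vertex N p q (Suc n) =
     (if fst (cw_triple N p q (L # lpp_vertex N p q n)) = 1
      then L # lpp_vertex N p q n
      else R # lpp_vertex N p q n)"

definition lpp :: "int \<Rightarrow> int \<Rightarrow> int \<Rightarrow> nat \<Rightarrow> real" where
  "lpp N p q n = cw_label (quad_root N p q) (lpp_vertex N p q n)"

lemma quad_root_pos:
  assumes "p\<^sup>2 < N" "q > 0"
  shows "quad_root N p q > 0"
proof -
  have "real_of_int (p\<^sup>2) < of_int N"
    using assms(1) by (simp only: of_int_less_iff)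
  hence "(real_of_int p)\<^sup>2 < of_int N" by simp
  hence "\<bar>real_of_int p\<bar> < sqrt (of_int N)"
    using real_less_rsqrt by fastforce
  thus ?thesis using assms(2) by (auto simp: quad_root_def)
qed

lemma cw_label_pos: "\<alpha> > 0 \<Longrightarrow> cw_label \<alpha> v > 0"
  by (induction \<alpha> v rule: cw_label.induct) (auto simp: add_pos_pos)

(* The triples are well formed and represent the labels. *)

lemma cw_triple_correct:
  assumes nonsq: "\<not> is_square N" and "p\<^sup>2 < N" "q > 0" "q dvd N - p\<^sup>2"
    and "cw_triple N p q v = (\<epsilon>, c, d)"
  shows "\<epsilon> \<in> {-1, 1} \<and> d > 0 \<and> d dvd N - c\<^sup>2 \<and>
         cw_label (quad_root N p q) v = (of_int \<epsilon> * sqrt (of_int N) + of_int c) / of_int d"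
  using assms(5)
proof (induction v arbitrary: \<epsilon> c d)
  case Nil
  thus ?case using assms by (auto simp: quad_root_def)
next
  case (Cons s v)
  obtain e a b where t: "cw_triple N p q v = (e, a, b)" by (cases "cw_triple N p q v")
  define x where "x = cw_label (quad_root N p q) v"
  define S where "S = sqrt (real_of_int N)"
  from Cons.IH[OF t] have e: "e \<in> {-1, 1}" and b: "b > 0" and dvd: "b dvd N - a\<^sup>2"
    and x: "x = (of_int e * S + of_int a) / of_int b" by (auto simp: x_def S_def)
  have xpos: "x > 0"
    unfolding x_def using assms by (intro cw_label_pos quad_root_pos)
  from dvd obtain k where k: "N - a\<^sup>2 = b * k" by (elim dvdE)
  have N0: "N > 0" using assms(2) by (smt (verit) zero_le_power2)
  show ?case
  proof (cases s)
    case R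
    have "N - (a + b)\<^sup>2 = b * (k - 2 * a - b)"
      using k by (simp add: power2_eq_square algebra_simps)
    moreover have "x + 1 = (of_int e * S + of_int (a + b)) / of_int b"
      using x b by (simp add: field_simps)
    ultimately show ?thesis
      using R Cons.prems t e b by (auto simp: x_def S_def)
  next
    case L
    define m where "m = k - 2 * a - b"
    have m: "N - (a + b)\<^sup>2 = b * m" "(a + b)\<^sup>2 - N = b * (- m)"
      using k by (simp_all add: m_def power2_eq_square algebra_simps)
    have "N \<noteq> (a + b)\<^sup>2" using nonsq by auto
    hence m0: "m \<noteq> 0" using m by auto
    have S2: "S * S = of_int N" using N0 by (simp add: S_def)
    have e2: "real_of_int e * of_int e = 1" using e by auto
    have bk: "of_int N = (of_int a)\<^sup>2 + real_of_int b * of_int k"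
    proof -
      have "N = a\<^sup>2 + b * k" using k by simp
      hence "real_of_int N = of_int (a\<^sup>2 + b * k)" by simp
      thus ?thesis by simp
    qed
    have pos: "of_int e * S + of_int a > 0"
      using xpos x b by (simp add: zero_less_divide_iff)
    have lab: "x / (x + 1) = (of_int (-e) * S + of_int (k - a)) / of_int m"
    proof -
      let ?y = "of_int e * S + real_of_int a"
      have 1: "x / (x + 1) = ?y / (?y + of_int b)"
      proof -
        have "x + 1 = (?y + of_int b) / of_int b" using x b by (simp add: add_divide_distrib)
        thus ?thesis using x b by simp
      qed
      have ee: "(of_int e * S) * (of_int e * S) = real_of_int N"
        using e2 S2 by (metis mult.assoc mult.left_commute mult.right_neutral)
      have "?y * of_int m = (of_int (-e) * S + of_int (k - a)) * (?y + of_int b)"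
        using ee bk by (simp add: m_def power2_eq_square algebra_simps)
      moreover have "?y + of_int b > 0" using pos b by simp
      ultimately show ?thesis using 1 m0 by (simp add: frac_eq_eq)
    qed
    have kdiv: "(N - a\<^sup>2) div b = k" "(N - (a + b)\<^sup>2) div b = m"
      "((a + b)\<^sup>2 - N) div b = - m"
      using k m b by (simp_all only: nonzero_mult_div_cancel_left) 
    have "N - (k - a)\<^sup>2 = m * (- k) + (N - a\<^sup>2 - b * k)"
      by (simp add: m_def power2_eq_square algebra_simps)
    hence dv: "m dvd N - (k - a)\<^sup>2" using k by simp
    have dv': "m dvd N - (a - k)\<^sup>2" using dv by (simp add: power2_commute)
    show ?thesis
    proof (cases "N - (a + b)\<^sup>2 > 0")
      case True
      hence "m > 0" using m b by (simp add: zero_less_mult_iff)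
      thus ?thesis
        using True L Cons.prems t e kdiv dv lab by (auto simp: x_def S_def)
    next
      case False
      hence "m < 0" using m b m0 by (simp add: zero_less_mult_iff)
      moreover have "x / (x + 1) = (of_int e * S + of_int (a - k)) / of_int (- m)"
        using lab m0 by (simp add: field_simps)
      moreover have "left_triple N (e, a, b) = (e, a - k, - m)"
        using False by (simp only: left_triple.simps kdiv if_False)
      hence "\<epsilon> = e" "c = a - k" "d = - m"
        using L Cons.prems t by simp_all
      ultimately show ?thesis
        using L e dv' unfolding x_def S_def by simp
    qed
  qed
qed

end

(* Along the path epsilon stays 1 and c^2 < N is preserved, so only finitely many triples occur.
   The step to the next triple is injective: with k = (N - c^2) / d, a left step preserves k, and
   N < (c' - d')^2 holds after a left step while (c' - d')^2 < N holds after a right step. Hence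
   the sequence of triples is purely periodic, and so is the sequence of labels. *)
theory Submission
  imports Defs
begin

text \<open>Two terms agree by the pigeonhole principle. Injectivity of \<open>f\<close> on
  \<open>A\<close> moves this coincidence back one index at a time, down to index 0, so that no
  preperiod remains.\<close>

lemma finite_inj_seq_purely_periodic:
  fixes s :: "nat \<Rightarrow> 'a"
  assumes "finite A" and inj: "inj_on f A"
    and mem: "\<And>n. s n \<in> A" and step: "\<And>n. s (Suc n) = f (s n)"
  shows "\<exists>T>0. \<forall>n. s (n + T) = s n"
proof -
  have "finite (range s)"
    using mem \<open>finite A\<close> by (meson finite_subset image_subsetI)
  hence "\<not> inj s"
    using finite_imageD infinite_UNIV_nat by blast
  then obtain i j where "i < j" "s i = s j"
    by (metis injI linorder_less_linear)
  then obtain T where T: "T > 0" "s (i + T) = s i"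
    by (metis less_imp_add_positive)
  have "s (i + T) = s i \<Longrightarrow> s T = s 0" for i
  proof (induction i)
    case (Suc i)
    thus ?case using inj mem step by (auto dest: inj_onD)
  qed simp
  hence T0: "s T = s 0" using T by blast
  have "s (n + T) = s n" for n
    by (induction n) (simp_all add: T0 step)
  thus ?thesis using T(1) by blast
qed

definition lpp_next :: "int \<Rightarrow> triple \<Rightarrow> triple" where
  "lpp_next N t = (if fst (left_triple N t) = 1 then left_triple N t else right_triple t)"

text \<open>For such a triple the label (sqrt N + c) / d is positive and its conjugate (c - sqrt N)
  / d is negative.\<close>

definition reduced_triples :: "int \<Rightarrow> triple set" where
  "reduced_triples N = {(1, c, d) | c d. c\<^sup>2 < N \<and> d > 0 \<and> d dvd N - c\<^sup>2}"

lemma cw_triple_lpp_vertex_Suc: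
  "cw_triple N p q (lpp_vertex N p q (Suc n)) = lpp_next N (cw_triple N p q (lpp_vertex N p q n))"
  by (simp add: lpp_next_def)

lemma finite_reduced_triples: "finite (reduced_triples N)"
proof (rule finite_subset)
  show "reduced_triples N \<subseteq> {1} \<times> {-N..N} \<times> {0..N}"
  proof (clarsimp simp: reduced_triples_def)
    fix c d :: int
    assume *: "c\<^sup>2 < N" "0 < d" "d dvd N - c\<^sup>2"
    have "\<bar>c\<bar> \<le> c\<^sup>2"
      using self_le_power[of "\<bar>c\<bar>" 2] by (cases "c = 0") simp_all
    moreover have "d \<le> N - c\<^sup>2"
      using * by (intro zdvd_imp_le) simp_all
    ultimately show "- N \<le> c \<and> c \<le> N \<and> d \<le> N"
      using * by (smt (verit) zero_le_power2)
  qed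
qed simp

text \<open>In the left case \<open>k\<close> is the quotient of \<open>N - c\<^sup>2\<close> by
  \<open>d\<close>. The equation with \<open>d' * k\<close> records that \<open>k\<close> is also
  the quotient for the new triple, which makes the step reversible.\<close>

lemma lpp_next_cases:
  assumes nonsq: "\<not> is_square N" and t: "t \<in> reduced_triples N"
  obtains
    (right) c d where "t = (1, c, d)" "lpp_next N t = (1, c + d, d)"
      "d > 0" "d dvd N - (c + d)\<^sup>2" "(c + d)\<^sup>2 < N" "c\<^sup>2 < N"
  | (left) c d k d' where "t = (1, c, d)" "lpp_next N t = (1, c - k, d')"
      "d > 0" "k > 0" "d' > 0" "N - (c - k)\<^sup>2 = d' * k" "d' = d + 2 * c - k"
proof -
  obtain c d where cd: "t = (1, c, d)" "c\<^sup>2 < N" "d > 0" "d dvd N - c\<^sup>2"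
    using t by (auto simp: reduced_triples_def)
  then obtain k where k: "N - c\<^sup>2 = d * k" by (elim dvdE)
  have kpos: "k > 0" using k cd by (smt (verit) zero_less_mult_pos)
  define d' where "d' = d + 2 * c - k"
  have d': "(c + d)\<^sup>2 - N = d * d'" "N - (c - k)\<^sup>2 = d' * k"
    using k by (simp_all add: d'_def power2_eq_square algebra_simps)
  show thesis
  \<comment> \<open>The left child flips the sign of epsilon exactly in the positive case, so this
    test decides the direction of the path.\<close>
  proof (cases "N - (c + d)\<^sup>2 > 0")
    case True
    have "lpp_next N t = (1, c + d, d)"
      using True cd by (simp add: lpp_next_def)
    moreover have "d dvd N - (c + d)\<^sup>2"
      using d'(1) by (metis dvd_triv_left dvd_diff_commute)
    ultimately show thesis using cd True right by simp
  next
    case False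
    \<comment> \<open>Equality would give \<open>d' = 0\<close>, a zero denominator in the left
      child.\<close>
    moreover have "(c + d)\<^sup>2 \<noteq> N" using nonsq by auto
    ultimately have "d * d' > 0" using d' by linarith
    hence "d' > 0" using cd zero_less_mult_pos by blast
    moreover have "(N - c\<^sup>2) div d = k" "((c + d)\<^sup>2 - N) div d = d'"
      using k d' cd by simp_all
    hence "lpp_next N t = (1, c - k, d')"
      using False cd by (simp add: lpp_next_def)
    ultimately show thesis using cd kpos d' left d'_def by blast
  qed
qed

lemma lpp_next_in_reduced_triples:
  assumes "\<not> is_square N" and "t \<in> reduced_triples N"
  shows "lpp_next N t \<in> reduced_triples N"
  using assms
proof (cases rule: lpp_next_cases)
  case (right c d)
  thus ?thesis by (simp add: reduced_triples_def)
next
  case (left c d k d')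
  have "(c - k)\<^sup>2 < N"
    using left by (smt (verit) mult_pos_pos)
  thus ?thesis using left by (simp add: reduced_triples_def)
qed

lemma inj_on_lpp_next:
  assumes nonsq: "\<not> is_square N"
  shows "inj_on (lpp_next N) (reduced_triples N)"
proof -
  have no_clash: False
    if "c\<^sup>2 < N" "d' = d" "c1 - k = c + d" "d' = d1 + 2 * c1 - k"
       "N - (c1 - k)\<^sup>2 = d' * k" "d1 > 0" "d' > 0"
    for c d c1 d1 k d' :: int
  proof -
    \<comment> \<open>Undoing a right step from a left child yields
      \<open>c1 - k - d' = - (c1 + d1)\<close>, whose square exceeds \<open>N\<close> by
      \<open>d' * d1\<close>.\<close>
    have "N - (c1 - k - d')\<^sup>2 = - (d' * d1)"
      using that by (simp add: power2_eq_square algebra_simps)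
    moreover have "d' * d1 > 0" using that by simp
    moreover have "c1 - k - d' = c" using that by simp
    ultimately show False using \<open>c\<^sup>2 < N\<close> by simp
  qed
  show ?thesis
  proof (rule inj_onI)
    fix t u
    assume t: "t \<in> reduced_triples N" and u: "u \<in> reduced_triples N"
      and eq: "lpp_next N t = lpp_next N u"
    show "t = u"
      using nonsq t
    proof (cases rule: lpp_next_cases)
      case R1: (right c d)
      from nonsq u show ?thesis
      proof (cases rule: lpp_next_cases)
        case (right c1 d1)
        thus ?thesis using R1 eq by simp
      next
        case (left c1 d1 k d')
        thus ?thesis using R1 eq no_clash[of c d' d c1 k d1] by simp
      qed
    next
      case L1: (left c d k d')
      from nonsq u show ?thesis
      proof (cases rule: lpp_next_cases)
        case (right c1 d1)
        thus ?thesis using L1 eq no_clash[of c1 d' d1 c k d] by simp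
      next
        case (left c1 d1 k1 d1')
        have same: "d1' = d'" "c1 - k1 = c - k" using left L1 eq by simp_all
        \<comment> \<open>Both sides equal \<open>N - (c - k)\<^sup>2\<close>. Once \<open>k\<close>
          is known, \<open>c\<close> follows from \<open>c - k\<close>, and \<open>d\<close> from
          \<open>d' = d + 2 * c - k\<close>.\<close>
        hence "d' * k = d' * k1" using left L1 by metis
        hence "k1 = k" using L1 by simp
        thus ?thesis using left L1 same by simp
      qed
    qed
  qed
qed

theorem proposition3:
  fixes N p q :: int
  assumes "N > 0" and "\<not> is_square N"
    and "p\<^sup>2 < N"
    and "q > 0" and "q dvd N - p\<^sup>2"
  shows "\<exists>T::nat. T > 0 \<and> (\<forall>n. lpp N p q (n + T) = lpp N p q n)"
proof -
  define s where "s n = cw_triple N p q (lpp_vertex N p q n)" for n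
  have step: "s (Suc n) = lpp_next N (s n)" for n
    unfolding s_def by (rule cw_triple_lpp_vertex_Suc)
  have "s n \<in> reduced_triples N" for n
  proof (induction n)
    case 0
    thus ?case using assms by (simp add: s_def reduced_triples_def)
  next
    case (Suc n)
    thus ?case using assms(2) step lpp_next_in_reduced_triples by simp
  qed
  then obtain T where T: "T > 0" "\<And>n. s (n + T) = s n"
    using finite_inj_seq_purely_periodic[OF finite_reduced_triples inj_on_lpp_next] assms(2) step
    by metis
  \<comment> \<open>The vertices of the path never repeat, only their triples do; the label is a
    function of the triple, so it inherits the period.\<close>
  have "lpp N p q m = lpp N p q n" if "s m = s n" for m n
  proof -
    obtain e c d where n: "s n = (e, c, d)" by (cases "s n")
    with that have "s m = (e, c, d)" by simp
    with n show ?thesis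
      using cw_triple_correct[OF assms(2-5)] unfolding s_def lpp_def by metis
  qed
  thus ?thesis using T by blast
qed

end
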